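(* Let $G=SU(2)$, let $(\mathcal H^n,U^n)$ be the irreducible unitary representation of highest weight $n$, $\mathcal B^n=\mathcal B(\mathcal H^n)$, $\alpha$ the conjugation action, $\kappa$ an irreducible representation of $\mathbb C\ell(\mathfrak g')$ on $\mathcal S=\mathbb C^2$, $\sigma$ the associated representation of $SU(2)$ on $\mathcal S$, $\tilde\sigma=\alpha\otimes\sigma$, $C$ the Casimir element, and $D=\sum_j\alpha_{E_j}\otimes\kappa_{\epsilon_j}$ the Dirac operator on $\mathcal B^n\otimes\mathcal S$ (all as in the context). Then $$D=\pm\tfrac12\left(\tilde\sigma_C-\alpha_C\otimes I^{\mathcal S}-I^{\mathcal B^n}\otimes\sigma_C\right),$$ where the sign depends on which of the two irreducible representations $\kappa$ of $\mathbb C\ell(\mathfrak g')$ on $\mathcal S=\mathbb C^2$ is chosen.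
   Context: $\mathfrak g=su(2)$ has basis $E_1=\begin{pmatrix}0&i\\ i&0\end{pmatrix}$, $E_2=\begin{pmatrix}0&-1\\1&0\end{pmatrix}$, $E_3=\begin{pmatrix}i&0\\0&-i\end{pmatrix}$, orthonormal for $\langle X,Y\rangle=-\tfrac12\mathrm{trace}(XY)$; $\{\epsilon_j\}$ is the dual (orthonormal) basis of $\mathfrak g'$. $\mathbb C\ell(\mathfrak g')$ is the complex Clifford algebra with $\epsilon_j\epsilon_k+\epsilon_k\epsilon_j=-2\delta_{jk}$, a C*-algebra with $\epsilon_j^*=-\epsilon_j$. Its central chirality element is $\boldsymbol\gamma=\epsilon_1\epsilon_2\epsilon_3$; it has exactly two inequivalent irreducible $*$-representations, both of dimension 2, having the same restriction (up to equivalence) to the even subalgebra and distinguished by $\kappa_{\boldsymbol\gamma}=I$ or $\kappa_{\boldsymbol\gamma}=-I$. $\dim\mathcal H^n=n+1$; $U^n$ also denotes the infinitesimal representation; $\alpha_X(T)=[U^n_X,T]$ for $X\in\mathfrak g$, $T\in\mathcal B^n$. $\mathrm{Spin}(\mathfrak g')$ is the subgroup of the invertible elements of $\mathbb C\ell(\mathfrak g')$ generated by products of two unit vectors of $\mathfrak g'$. $\widehat{\mathrm{Cad}}:SU(2)\to\mathrm{Spin}(\mathfrak g')$ is the homomorphism such that conjugation by $\widehat{\mathrm{Cad}}_x$ on $\mathfrak g'\subset\mathbb C\ell(\mathfrak g')$ is the coadjoint action $\mathrm{Cad}_x$, and $\sigma=\kappa\circ\widehat{\mathrm{Cad}}$.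 Infinitesimally $\tilde\sigma_X=\alpha_X\otimes I^{\mathcal S}+I^{\mathcal B^n}\otimes\sigma_X$. The Casimir element is $C=E_1^2+E_2^2+E_3^2$ in the universal enveloping algebra; for a representation $\pi$ of $\mathfrak g$, $\pi_C=\sum_j(\pi_{E_j})^2$. *)

theory Defs
  imports "HOL-Analysis.Analysis"
begin

section \<open>Matrices, $SU(2)$ and its Lie algebra\<close>

text \<open>Matrices are multiplied with \<open>**\<close> and the identity is \<open>mat 1\<close>; the ring operations
  \<open>*\<close> and \<open>1\<close> on vectors are componentwise and are not used for matrices.\<close>

definition hadj :: "complex^'n^'m \<Rightarrow> complex^'m^'n" where
  "hadj A = (\<chi> i j. cnj (A $ j $ i))"

definition unitary_mat :: "complex^'n^'n \<Rightarrow> bool" where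
  "unitary_mat A \<longleftrightarrow> hadj A ** A = mat 1 \<and> A ** hadj A = mat 1"

definition cscale :: "complex \<Rightarrow> complex^'n^'m \<Rightarrow> complex^'n^'m" where
  "cscale c = map_matrix ((*) c)"

definition mexp :: "complex^'n^'n \<Rightarrow> complex^'n^'n" where
  "mexp A = (\<Sum>k. (1 / fact k) *\<^sub>R (((**) A ^^ k) (mat 1)))"

definition SU2 :: "(complex^2^2) set" where
  "SU2 = {x. unitary_mat x \<and> det x = 1}"

definition su2 :: "(complex^2^2) set" where
  "su2 = {X. hadj X = - X \<and> trace X = 0}"

definition su2_inner :: "complex^2^2 \<Rightarrow> complex^2^2 \<Rightarrow> real" where
  "su2_inner X Y = Re (- (1/2) * trace (X ** Y))"

text \<open>The index type \<open>3\<close> has the elements \<open>1\<close>, \<open>2\<close>, \<open>3\<close> (where \<open>3 = 0\<close>).\<close>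

definition su2E :: "3 \<Rightarrow> complex^2^2" where
  "su2E j =
    (if j = 1 then vector [vector [0, \<i>], vector [\<i>, 0]]
     else if j = 2 then vector [vector [0, -1], vector [1, 0]]
     else vector [vector [\<i>, 0], vector [0, - \<i>]])"

text \<open>Elements of the dual space are functionals on all matrices of which only the
  restriction to \<open>su2\<close> matters.\<close>

definition su2_dual :: "(complex^2^2 \<Rightarrow> real) set" where
  "su2_dual = {\<mu>. (\<forall>X\<in>su2. \<forall>Y\<in>su2. \<mu> (X + Y) = \<mu> X + \<mu> Y) \<and>
                  (\<forall>r. \<forall>X\<in>su2. \<mu> (r *\<^sub>R X) = r * \<mu> X)}"

definition su2_eps :: "3 \<Rightarrow> complex^2^2 \<Rightarrow> real" where
  "su2_eps j = su2_inner (su2E j)"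

definition su2_dual_inner :: "(complex^2^2 \<Rightarrow> real) \<Rightarrow> (complex^2^2 \<Rightarrow> real) \<Rightarrow> real" where
  "su2_dual_inner \<mu> \<nu> = (\<Sum>j\<in>UNIV. \<mu> (su2E j) * \<nu> (su2E j))"

definition Ad :: "complex^2^2 \<Rightarrow> complex^2^2 \<Rightarrow> complex^2^2" where
  "Ad x X = x ** X ** matrix_inv x"

definition Cad :: "complex^2^2 \<Rightarrow> (complex^2^2 \<Rightarrow> real) \<Rightarrow> (complex^2^2 \<Rightarrow> real)" where
  "Cad x \<mu> = (\<lambda>X. \<mu> (Ad (matrix_inv x) X))"


section \<open>The complex Clifford algebra\<close>

text \<open>An element is the family of its coefficients with respect to the basis
  $e_A = \epsilon_{a_1} \cdots \epsilon_{a_k}$, where $A = \{a_1 < \dots < a_k\}$ runs over the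
  subsets of the index set. The relations
  $\epsilon_j\epsilon_k + \epsilon_k\epsilon_j = -2\delta_{jk}$ give
  $e_A e_B = (-1)^m e_{A \triangle B}$, where $m$ counts the pairs $(a, b) \in A \times B$
  with $a > b$ (transpositions) or $a = b$ (squares $-1$).\<close>

datatype 'i cliff = Cliff (coeff: "'i set \<Rightarrow> complex")

definition cl_sign :: "'i::{finite,linorder} set \<Rightarrow> 'i set \<Rightarrow> complex" where
  "cl_sign A B = (\<Prod>a\<in>A. \<Prod>b\<in>B. if b \<le> a then -1 else 1)"

definition cl_basis :: "'i set \<Rightarrow> 'i cliff" where
  "cl_basis A = Cliff (\<lambda>B. if B = A then 1 else 0)"

lemma cliff_eq_iff: "x = y \<longleftrightarrow> (\<forall>A. coeff x A = coeff y A)"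
  by (metis cliff.expand ext)

lemma cl_sign_UNIV:
  "cl_sign A B = (\<Prod>a\<in>UNIV. \<Prod>b\<in>UNIV. if a \<in> A \<and> b \<in> B \<and> b \<le> a then -1 else 1)"
proof -
  have "cl_sign A B =
      (\<Prod>a\<in>UNIV. if a \<in> A then (\<Prod>b\<in>UNIV. if b \<in> B then if b \<le> a then -1 else 1 else 1) else 1)"
    unfolding cl_sign_def by (simp flip: prod.inter_restrict)
  also have "\<dots> = (\<Prod>a\<in>UNIV. \<Prod>b\<in>UNIV. if a \<in> A \<and> b \<in> B \<and> b \<le> a then -1 else 1)"
    by (intro prod.cong refl) (auto intro!: prod.cong)
  finally show ?thesis .
qed

lemma cl_sign_sym_diff_left: "cl_sign (sym_diff A B) C = cl_sign A C * cl_sign B C"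
  unfolding cl_sign_UNIV prod.distrib[symmetric] by (intro prod.cong refl) auto

lemma cl_sign_sym_diff_right: "cl_sign A (sym_diff B C) = cl_sign A B * cl_sign A C"
  unfolding cl_sign_UNIV prod.distrib[symmetric] by (intro prod.cong refl) auto

lemma cl_sign_empty [simp]: "cl_sign {} B = 1" "cl_sign A {} = 1"
  by (simp_all add: cl_sign_def)

lemma sym_diff_cancel [simp]: "sym_diff A (sym_diff A B) = B"
  by auto

instantiation cliff :: ("{finite,linorder}") ring_1
begin

definition "0 = Cliff (\<lambda>_. 0)"
definition "1 = cl_basis {}"
definition "x + y = Cliff (\<lambda>A. coeff x A + coeff y A)"
definition "- x = Cliff (\<lambda>A. - coeff x A)"
definition "x - y = Cliff (\<lambda>A. coeff x A - coeff y A)"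
definition "x * y = Cliff (\<lambda>C. \<Sum>A\<in>UNIV.
    cl_sign A (sym_diff A C) * coeff x A * coeff y (sym_diff A C))"

instance
proof
  fix a b c :: "'a cliff"
  show "a * b * c = a * (b * c)"
  proof -
    have "coeff (a * b * c) C = coeff (a * (b * c)) C" for C
    proof -
      have "coeff (a * b * c) C = (\<Sum>D\<in>UNIV. \<Sum>A\<in>UNIV. cl_sign D (sym_diff D C) *
          cl_sign A (sym_diff A D) * coeff a A * coeff b (sym_diff A D) * coeff c (sym_diff D C))"
        by (simp add: times_cliff_def sum_distrib_left sum_distrib_right mult.assoc)
      also have "\<dots> = (\<Sum>A\<in>UNIV. \<Sum>D\<in>UNIV. cl_sign D (sym_diff D C) *
          cl_sign A (sym_diff A D) * coeff a A * coeff b (sym_diff A D) * coeff c (sym_diff D C))"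
        by (rule sum.swap)
      also have "\<dots> = (\<Sum>A\<in>UNIV. \<Sum>B\<in>UNIV. cl_sign (sym_diff A B) (sym_diff (sym_diff A B) C) *
          cl_sign A B * coeff a A * coeff b B * coeff c (sym_diff (sym_diff A B) C))"
      proof (rule sum.cong[OF refl])
        fix A
        show "(\<Sum>D\<in>UNIV. cl_sign D (sym_diff D C) *
            cl_sign A (sym_diff A D) * coeff a A * coeff b (sym_diff A D) * coeff c (sym_diff D C))
          = (\<Sum>B\<in>UNIV. cl_sign (sym_diff A B) (sym_diff (sym_diff A B) C) *
            cl_sign A B * coeff a A * coeff b B * coeff c (sym_diff (sym_diff A B) C))"
          by (rule sum.reindex_bij_witness[where i = "sym_diff A" and j = "sym_diff A"])
            (simp_all only: UNIV_I sym_diff_cancel)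
      qed
      also have "\<dots> = (\<Sum>A\<in>UNIV. \<Sum>B\<in>UNIV. cl_sign A (sym_diff A C) *
          cl_sign B (sym_diff B (sym_diff A C)) * coeff a A * coeff b B *
          coeff c (sym_diff B (sym_diff A C)))"
      proof (intro sum.cong refl)
        fix A B
        have eq: "sym_diff (sym_diff A B) C = sym_diff B (sym_diff A C)" by auto
        have sq: "cl_sign A B * cl_sign A B = 1"
          unfolding cl_sign_UNIV prod.distrib[symmetric] by (intro prod.neutral ballI) auto
        have "cl_sign (sym_diff A B) (sym_diff B (sym_diff A C)) * cl_sign A B =
            cl_sign A (sym_diff A C) * cl_sign B (sym_diff B (sym_diff A C)) *
            (cl_sign A B * cl_sign A B)"
          by (simp only: cl_sign_sym_diff_left cl_sign_sym_diff_right ac_simps)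
        then show "cl_sign (sym_diff A B) (sym_diff (sym_diff A B) C) *
            cl_sign A B * coeff a A * coeff b B * coeff c (sym_diff (sym_diff A B) C) =
            cl_sign A (sym_diff A C) * cl_sign B (sym_diff B (sym_diff A C)) *
            coeff a A * coeff b B * coeff c (sym_diff B (sym_diff A C))"
          unfolding eq sq by simp
      qed
      also have "\<dots> = coeff (a * (b * c)) C"
        by (simp add: times_cliff_def sum_distrib_left ac_simps)
      finally show ?thesis .
    qed
    then show ?thesis by (simp add: cliff_eq_iff)
  qed
  show "1 * a = a"
  proof -
    have "(\<Sum>A\<in>UNIV. cl_sign A (sym_diff A C) * (if A = {} then 1 else 0) * coeff a (sym_diff A C))
        = coeff a C" for C
    proof -
      have "(\<Sum>A\<in>UNIV. cl_sign A (sym_diff A C) * (if A = {} then 1 else 0) * coeff a (sym_diff A C))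
          = (\<Sum>A\<in>(UNIV :: 'a set set). if A = {} then coeff a C else 0)"
        by (rule sum.cong[OF refl]) auto
      then show ?thesis by simp
    qed
    then show ?thesis
      by (simp add: cliff_eq_iff times_cliff_def one_cliff_def cl_basis_def)
  qed
  show "a * 1 = a"
  proof -
    have "(\<Sum>A\<in>UNIV. cl_sign A (sym_diff A C) * coeff a A * (if sym_diff A C = {} then 1 else 0))
        = coeff a C" for C
    proof -
      have "(\<Sum>A\<in>UNIV. cl_sign A (sym_diff A C) * coeff a A * (if sym_diff A C = {} then 1 else 0))
          = (\<Sum>A\<in>UNIV. if A = C then coeff a C else 0)"
        by (rule sum.cong[OF refl]) auto
      then show ?thesis by simp
    qed
    then show ?thesis
      by (simp add: cliff_eq_iff times_cliff_def one_cliff_def cl_basis_def)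
  qed
  show "(0 :: 'a cliff) \<noteq> 1"
    by (auto simp: cliff_eq_iff zero_cliff_def one_cliff_def cl_basis_def)
qed (simp_all add: cliff_eq_iff zero_cliff_def plus_cliff_def uminus_cliff_def minus_cliff_def
      times_cliff_def algebra_simps sum.distrib)

end

definition cl_scale :: "complex \<Rightarrow> 'i cliff \<Rightarrow> 'i cliff" where
  "cl_scale c x = Cliff (\<lambda>A. c * coeff x A)"

text \<open>The involution is antilinear and maps $e_A$ to $e_A^{-1}$, that is, to
  \<open>cl_sign A A\<close> times $e_A$.\<close>

definition cl_star :: "'i::{finite,linorder} cliff \<Rightarrow> 'i cliff" where
  "cl_star x = Cliff (\<lambda>A. cl_sign A A * cnj (coeff x A))"

definition cl_gen :: "'i \<Rightarrow> 'i cliff" where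
  "cl_gen j = cl_basis {j}"

definition cl_gamma :: "3 cliff" where
  "cl_gamma = cl_gen 1 * cl_gen 2 * cl_gen 3"

text \<open>The inclusion of the dual of the Lie algebra into the Clifford algebra.\<close>

definition cl_vec :: "(complex^2^2 \<Rightarrow> real) \<Rightarrow> 3 cliff" where
  "cl_vec \<mu> = (\<Sum>j\<in>UNIV. cl_scale (of_real (\<mu> (su2E j))) (cl_gen j))"

lemma cl_basis_mult:
  fixes A B :: "'i::{finite,linorder} set"
  shows "cl_basis A * cl_basis B = cl_scale (cl_sign A B) (cl_basis (sym_diff A B))"
proof -
  have "(\<Sum>D\<in>UNIV. cl_sign D (sym_diff D C) * (if D = A then 1 else 0) *
        (if sym_diff D C = B then 1 else 0))
      = (\<Sum>D\<in>UNIV. if D = A then (if C = sym_diff A B then cl_sign A B else 0) else 0)" for C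
    by (rule sum.cong) auto
  then show ?thesis
    by (simp add: cliff_eq_iff times_cliff_def cl_basis_def cl_scale_def)
qed

lemma cl_basis_insert:
  fixes A :: "'i::{finite,linorder} set"
  assumes "\<And>b. b \<in> A \<Longrightarrow> a < b"
  shows "cl_basis (insert a A) = cl_gen a * cl_basis A"
proof -
  have "sym_diff {a} A = insert a A" "cl_sign {a} A = 1"
    using assms by (auto simp: cl_sign_def intro!: prod.neutral) (meson leD)+
  then show ?thesis
    by (simp add: cl_gen_def cl_basis_mult) (simp add: cl_scale_def)
qed

lemma clifford_relation:
  fixes j k :: "'i::{finite,linorder}"
  shows "cl_gen j * cl_gen k + cl_gen k * cl_gen j = (if j = k then - 2 else 0)"
proof (cases "j = k")
  case True
  have "(2 :: 'i cliff) = 1 + 1" by simp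
  with True show ?thesis
    by (simp add: cl_gen_def cl_basis_mult cl_sign_def del: one_add_one)
      (simp add: cliff_eq_iff plus_cliff_def uminus_cliff_def one_cliff_def cl_scale_def)
next
  case False
  then have "sym_diff {k} {j} = sym_diff {j} {k}" "cl_sign {k} {j} = - cl_sign {j} {k}"
    by (auto simp: cl_sign_def)
  with False show ?thesis
    by (simp only: cl_gen_def cl_basis_mult)
      (simp add: cliff_eq_iff plus_cliff_def zero_cliff_def cl_scale_def)
qed

lemma cl_star_gen: "cl_star (cl_gen j) = - cl_gen (j :: 'i::{finite,linorder})"
  by (simp add: cliff_eq_iff cl_star_def cl_gen_def cl_basis_def uminus_cliff_def cl_sign_def)

lemma cl_star_basis_mult:
  fixes A B :: "'i::{finite,linorder} set"
  shows "cl_star (cl_basis A * cl_basis B) = cl_star (cl_basis B) * cl_star (cl_basis A)"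
proof -
  have sq: "cl_sign A B * cl_sign A B = 1"
    unfolding cl_sign_UNIV prod.distrib[symmetric] by (intro prod.neutral ballI) auto
  have cn: "cnj (cl_sign A B) = cl_sign A B"
    unfolding cl_sign_def cnj_prod by (intro prod.cong refl) auto
  have star: "cl_star (cl_basis C) = cl_scale (cl_sign C C) (cl_basis C)" for C :: "'i set"
    by (simp add: cliff_eq_iff cl_star_def cl_basis_def cl_scale_def)
  have mult: "cl_scale c x * cl_scale d y = cl_scale (c * d) (x * y)" for c d and x y :: "'i cliff"
    by (simp add: cliff_eq_iff times_cliff_def cl_scale_def sum_distrib_left ac_simps)
  have comm: "sym_diff B A = sym_diff A B" by auto
  have "cl_sign (sym_diff A B) (sym_diff A B) * cl_sign A B
      = cl_sign B B * cl_sign A A * cl_sign B A * (cl_sign A B * cl_sign A B)"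
    by (simp only: cl_sign_sym_diff_left cl_sign_sym_diff_right ac_simps)
  then have sgn: "cl_sign (sym_diff A B) (sym_diff A B) * cl_sign A B
      = cl_sign B B * cl_sign A A * cl_sign B A"
    unfolding sq by simp
  have "cl_star (cl_basis A * cl_basis B)
      = cl_scale (cl_sign (sym_diff A B) (sym_diff A B) * cl_sign A B) (cl_basis (sym_diff A B))"
    unfolding cl_basis_mult
    by (simp add: cliff_eq_iff cl_star_def cl_basis_def cl_scale_def cn)
  also have "\<dots> = cl_star (cl_basis B) * cl_star (cl_basis A)"
    unfolding sgn star mult cl_basis_mult comm
    by (simp add: cliff_eq_iff cl_scale_def)
  finally show ?thesis .
qed

text \<open>The subgroup of the group of invertible elements generated by the products of two
  unit vectors.\<close>

inductive_set Spin :: "3 cliff set" where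
  one: "1 \<in> Spin"
| gen: "\<lbrakk>\<mu> \<in> su2_dual; su2_dual_inner \<mu> \<mu> = 1; \<nu> \<in> su2_dual; su2_dual_inner \<nu> \<nu> = 1\<rbrakk>
    \<Longrightarrow> cl_vec \<mu> * cl_vec \<nu> \<in> Spin"
| mult: "\<lbrakk>x \<in> Spin; y \<in> Spin\<rbrakk> \<Longrightarrow> x * y \<in> Spin"
| inv: "\<lbrakk>x \<in> Spin; x * y = 1; y * x = 1\<rbrakk> \<Longrightarrow> y \<in> Spin"

definition cl_inv :: "'i::{finite,linorder} cliff \<Rightarrow> 'i cliff" where
  "cl_inv x = (THE y. x * y = 1 \<and> y * x = 1)"

text \<open>These properties determine the values of \<open>h\<close> on \<open>SU2\<close>.\<close>

definition is_Cad_hat :: "(complex^2^2 \<Rightarrow> 3 cliff) \<Rightarrow> bool" where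
  "is_Cad_hat h \<longleftrightarrow>
    (\<forall>x\<in>SU2. h x \<in> Spin) \<and>
    (\<forall>x\<in>SU2. \<forall>y\<in>SU2. h (x ** y) = h x * h y) \<and>
    (\<forall>x\<in>SU2. \<forall>\<mu>\<in>su2_dual. h x * cl_vec \<mu> * cl_inv (h x) = cl_vec (Cad x \<mu>))"


section \<open>Representations\<close>

definition irreducible_mats :: "(complex^'n^'n) set \<Rightarrow> bool" where
  "irreducible_mats \<A> \<longleftrightarrow>
    (\<forall>W. vec.subspace W \<and> (\<forall>M\<in>\<A>. \<forall>w\<in>W. M *v w \<in> W) \<longrightarrow> W = {0} \<or> W = UNIV)"

definition irreducible_unitary_rep :: "(complex^2^2 \<Rightarrow> complex^'n^'n) \<Rightarrow> bool" where
  "irreducible_unitary_rep U \<longleftrightarrow>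
    (\<forall>x\<in>SU2. unitary_mat (U x)) \<and>
    (\<forall>x\<in>SU2. \<forall>y\<in>SU2. U (x ** y) = U x ** U y) \<and>
    continuous_on SU2 U \<and>
    irreducible_mats (U ` SU2)"

text \<open>Weights refer to the maximal torus of the matrices
  $\exp(t E_3) = \mathrm{diag}(e^{it}, e^{-it})$, so that the defining representation on
  $\mathbb C^2$ has the weights $1$ and $-1$.\<close>

definition is_weight :: "(complex^2^2 \<Rightarrow> complex^'n^'n) \<Rightarrow> int \<Rightarrow> bool" where
  "is_weight U m \<longleftrightarrow>
    (\<exists>v. v \<noteq> 0 \<and> (\<forall>t::real. U (mexp (t *\<^sub>R su2E 3)) *v v = cis (of_int m * t) *s v))"

definition has_highest_weight :: "(complex^2^2 \<Rightarrow> complex^'n^'n) \<Rightarrow> nat \<Rightarrow> bool" where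
  "has_highest_weight U n \<longleftrightarrow> is_weight U (int n) \<and> (\<forall>m. is_weight U m \<longrightarrow> m \<le> int n)"

definition irreducible_cliff_star_rep :: "(3 cliff \<Rightarrow> complex^'s^'s) \<Rightarrow> bool" where
  "irreducible_cliff_star_rep \<kappa> \<longleftrightarrow>
    (\<forall>x y. \<kappa> (x + y) = \<kappa> x + \<kappa> y) \<and>
    (\<forall>c x. \<kappa> (cl_scale c x) = cscale c (\<kappa> x)) \<and>
    (\<forall>x y. \<kappa> (x * y) = \<kappa> x ** \<kappa> y) \<and>
    \<kappa> 1 = mat 1 \<and>
    (\<forall>x. \<kappa> (cl_star x) = hadj (\<kappa> x)) \<and>
    irreducible_mats (range \<kappa>)"

text \<open>Here and below a representation assigns an operator to each element of \<open>SU2\<close>.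
  Its infinitesimal version is taken pointwise on vectors.\<close>

definition infinitesimal ::
  "(complex^2^2 \<Rightarrow> 'v \<Rightarrow> 'v::real_normed_vector) \<Rightarrow> complex^2^2 \<Rightarrow> 'v \<Rightarrow> 'v" where
  "infinitesimal \<pi> X v = vector_derivative (\<lambda>t. \<pi> (mexp (t *\<^sub>R X)) v) (at 0)"

definition casimir :: "(complex^2^2 \<Rightarrow> 'v \<Rightarrow> 'v::real_normed_vector) \<Rightarrow> 'v \<Rightarrow> 'v" where
  "casimir \<pi> v = (\<Sum>j\<in>UNIV. infinitesimal \<pi> (su2E j) (infinitesimal \<pi> (su2E j) v))"

text \<open>The tensor product of the matrix algebra with $\mathbb C^s$ is realized as the space of
  $s$-tuples of matrices.\<close>

definition tensor :: "complex^'n^'n \<Rightarrow> complex^'s \<Rightarrow> complex^'n^'n^'s" where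
  "tensor T \<psi> = (\<chi> i. cscale (\<psi> $ i) T)"

definition op_tensor ::
  "(complex^'n^'n \<Rightarrow> complex^'n^'n) \<Rightarrow> (complex^'s \<Rightarrow> complex^'s)
    \<Rightarrow> complex^'n^'n^'s \<Rightarrow> complex^'n^'n^'s" where
  "op_tensor A K v = (\<Sum>j\<in>UNIV. tensor (A (v $ j)) (K (axis j 1)))"

lemma op_tensor_tensor:
  assumes "\<And>c T. A (cscale c T) = cscale c (A T)"
    and "Vector_Spaces.linear (*s) (*s) K"
  shows "op_tensor A K (tensor T \<psi>) = tensor (A T) (K \<psi>)"
proof -
  interpret K: Vector_Spaces.linear "(*s)" "(*s)" K by fact
  have "K \<psi> = (\<Sum>j\<in>UNIV. \<psi> $ j *s K (axis j 1))"
    by (subst basis_expansion[of \<psi>, symmetric]) (simp add: K.sum K.scale)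
  then show ?thesis
    unfolding op_tensor_def tensor_def vec_lambda_beta assms(1)
    by (simp add: vec_eq_iff cscale_def sum_distrib_left ac_simps)
qed

text \<open>The infinitesimal versions of the next two kinds of representations are
  $\alpha_X(T) = [U_X, T]$ and
  $\tilde\sigma_X = \alpha_X \otimes I + I \otimes \sigma_X$.\<close>

definition conj_action ::
  "(complex^2^2 \<Rightarrow> complex^'n^'n) \<Rightarrow> complex^2^2 \<Rightarrow> complex^'n^'n \<Rightarrow> complex^'n^'n" where
  "conj_action U x T = U x ** T ** hadj (U x)"

definition tensor_rep ::
  "(complex^2^2 \<Rightarrow> complex^'n^'n \<Rightarrow> complex^'n^'n) \<Rightarrow> (complex^2^2 \<Rightarrow> complex^'s \<Rightarrow> complex^'s)
    \<Rightarrow> complex^2^2 \<Rightarrow> complex^'n^'n^'s \<Rightarrow> complex^'n^'n^'s" where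
  "tensor_rep \<alpha> \<sigma> x = op_tensor (\<alpha> x) (\<sigma> x)"

definition spin_rep ::
  "(3 cliff \<Rightarrow> complex^'s^'s) \<Rightarrow> (complex^2^2 \<Rightarrow> 3 cliff) \<Rightarrow> complex^2^2
    \<Rightarrow> complex^'s \<Rightarrow> complex^'s" where
  "spin_rep \<kappa> h x = (*v) (\<kappa> (h x))"

definition dirac ::
  "(complex^2^2 \<Rightarrow> complex^'n^'n \<Rightarrow> complex^'n^'n) \<Rightarrow> (3 cliff \<Rightarrow> complex^'s^'s)
    \<Rightarrow> complex^'n^'n^'s \<Rightarrow> complex^'n^'n^'s" where
  "dirac \<alpha> \<kappa> v =
    (\<Sum>j\<in>UNIV. op_tensor (infinitesimal \<alpha> (su2E j)) ((*v) (\<kappa> (cl_vec (su2_eps j)))) v)"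

end

theory Submission
  imports Defs
begin

text \<open>The matrices $E_j$ are quaternion units: $E_j^2 = -1$ and $E_1E_2 = E_3$, cyclically. So are
  the even Clifford elements $s_1 = \epsilon_2\epsilon_3$, $s_2 = \epsilon_3\epsilon_1$,
  $s_3 = \epsilon_1\epsilon_2$. Sending one triple to the other identifies $SU(2)$, the unit
  quaternions among matrices, with the unit quaternions of the even Clifford algebra; this map
  implements the coadjoint action by conjugation (\<open>quat_cl_implements_Cad\<close>).

  Any other homomorphism \<open>h\<close> into \<open>Spin\<close> with this property differs from it at each point by a
  central element of \<open>Spin\<close>. All elements of \<open>Spin\<close> are unit quaternions, and the only central
  ones are $\pm 1$ (\<open>Cad_hat_quat_up_to_sign\<close>). On a one-parameter group the sign disappears,
  since $h(\exp(tE_j)) = h(\exp(\frac t2 E_j))^2$. Therefore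
  $h(\exp(tE_j)) = \cos t + \sin t\, s_j$ (\<open>Cad_hat_mexp\<close>), and $\sigma_{E_j} = \kappa(s_j)$.

  On the other factor, the derivative $\alpha_{E_j}$ exists because a continuous one-parameter
  group of matrices is differentiable (\<open>continuous_one_parameter_group_differentiable\<close>). With both
  derivatives known, the product rule gives
  $\tilde\sigma_{E_j} = \alpha_{E_j} \otimes I + I \otimes \sigma_{E_j}$. The two summands
  commute, so squaring and summing over $j$ leaves
  $\tilde\sigma_C - \alpha_C \otimes I - I \otimes \sigma_C
    = 2 \sum_j \alpha_{E_j} \otimes \kappa(s_j)$ (\<open>casimir_tensor_rep\<close>).

  Finally $\epsilon_j = -\gamma s_j$ for the central element
  $\gamma = \epsilon_1\epsilon_2\epsilon_3$, whose square is $1$. By irreducibility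
  $\kappa(\gamma) = \pm I$ (\<open>cliff_rep_gamma\<close>), so $\kappa(\epsilon_j) = \mp\kappa(s_j)$, and the
  sum above is $\mp D$.\<close>


section \<open>Computing in the Clifford algebra\<close>

text \<open>The real structure lets the simplifier treat quaternion coefficients as scalars.\<close>

instantiation cliff :: ("{finite,linorder}") real_algebra_1
begin

definition scaleR_cliff :: "real \<Rightarrow> 'a cliff \<Rightarrow> 'a cliff" where
  "scaleR_cliff r = cl_scale (of_real r)"

instance
  by standard
    (simp_all add: cliff_eq_iff scaleR_cliff_def cl_scale_def plus_cliff_def times_cliff_def
      algebra_simps sum_distrib_left)

end

lemma cl_gen_square: "cl_gen j * cl_gen j = - (1 :: 'i::{finite,linorder} cliff)"
proof -
  have "2 *\<^sub>R (cl_gen j * cl_gen j) = 2 *\<^sub>R (- (1 :: 'i cliff))"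
    using clifford_relation[of j j] by (simp add: scaleR_2)
  then show ?thesis
    by (metis scaleR_cancel_left zero_neq_numeral)
qed

lemma cl_gen_anticommute:
  "j \<noteq> k \<Longrightarrow> cl_gen j * cl_gen k = - (cl_gen k * cl_gen (j :: 'i::{finite,linorder}))"
  using clifford_relation[of j k] by (simp add: add_eq_0_iff)

lemma index3_neq [simp]:
  "(1::3) \<noteq> 2" "(2::3) \<noteq> 1" "(1::3) \<noteq> 3" "(3::3) \<noteq> 1" "(2::3) \<noteq> 3" "(3::3) \<noteq> 2"
  by auto

lemma mult_eq_left: "a * b = c \<Longrightarrow> a * (b * y) = c * (y::'a::semigroup_mult)"
  by (metis mult.assoc)

text \<open>As rewrite rules these bring every product of generators into the form of a sign times
  $\epsilon_1^a\epsilon_2^b\epsilon_3^c$ with $a, b, c \le 1$. The versions with a further factor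
  \<open>y\<close> are needed because products are nested to the right.\<close>

lemma cl_gen_normalize:
  fixes y :: "3 cliff"
  shows "cl_gen j * cl_gen j = - (1 :: 3 cliff)" "cl_gen j * (cl_gen j * y) = - y"
    "cl_gen 2 * cl_gen 1 = - (cl_gen 1 * cl_gen 2 :: 3 cliff)"
    "cl_gen 2 * (cl_gen 1 * y) = - (cl_gen 1 * (cl_gen 2 * y))"
    "cl_gen 3 * cl_gen 1 = - (cl_gen 1 * cl_gen 3 :: 3 cliff)"
    "cl_gen 3 * (cl_gen 1 * y) = - (cl_gen 1 * (cl_gen 3 * y))"
    "cl_gen 3 * cl_gen 2 = - (cl_gen 2 * cl_gen 3 :: 3 cliff)"
    "cl_gen 3 * (cl_gen 2 * y) = - (cl_gen 2 * (cl_gen 3 * y))"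
  using mult_eq_left[OF cl_gen_square[of j], of y]
    mult_eq_left[OF cl_gen_anticommute[of 2 1], of y]
    mult_eq_left[OF cl_gen_anticommute[of 3 1], of y]
    mult_eq_left[OF cl_gen_anticommute[of 3 2], of y]
  by (simp_all add: cl_gen_square cl_gen_anticommute[of 2 1] cl_gen_anticommute[of 3 1]
      cl_gen_anticommute[of 3 2] mult.assoc)

text \<open>These are the images of the $E_j$ under the differential of the spin lift; the cyclic order of
  the factors makes them satisfy the same multiplication table.\<close>

definition spin_gen :: "3 \<Rightarrow> 3 cliff" where
  "spin_gen j = (if j = 1 then cl_gen 2 * cl_gen 3 else if j = 2 then cl_gen 3 * cl_gen 1
     else cl_gen 1 * cl_gen 2)"

lemma spin_gen_square: "spin_gen j * spin_gen j = - 1"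
  by (simp add: spin_gen_def cl_gen_normalize mult.assoc)

lemma cl_scale_mult:
  "cl_scale c x * y = cl_scale c (x * y)"
  "x * cl_scale c y = cl_scale c (x * (y :: 'i::{finite,linorder} cliff))"
  by (simp_all add: cliff_eq_iff times_cliff_def cl_scale_def sum_distrib_left ac_simps)

lemma coeff_sum: "coeff (\<Sum>i\<in>I. f i) A = (\<Sum>i\<in>I. coeff (f i :: 'i::{finite,linorder} cliff) A)"
  by (induction I rule: infinite_finite_induct) (simp_all add: zero_cliff_def plus_cliff_def)

lemma cliff_expansion:
  fixes x :: "'i::{finite,linorder} cliff"
  shows "x = (\<Sum>A\<in>UNIV. cl_scale (coeff x A) (cl_basis A))"
  by (simp add: cliff_eq_iff coeff_sum cl_scale_def cl_basis_def if_distrib cong: if_cong)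

text \<open>The basis elements are products of generators, and every element is a linear combination of
  basis elements.\<close>

lemma commute_cl_gen_imp_central:
  fixes x z :: "'i::{finite,linorder} cliff"
  assumes "\<And>j. z * cl_gen j = cl_gen j * z"
  shows "z * x = x * z"
proof -
  have "z * cl_basis A = cl_basis A * z" if "finite A" for A
    using that
  proof (induction A rule: finite_linorder_min_induct)
    case empty
    show ?case by (simp flip: one_cliff_def)
  next
    case (insert a A)
    then have "cl_basis (insert a A) = cl_gen a * cl_basis A"
      by (intro cl_basis_insert) auto
    then show ?case
      by (metis assms insert.IH mult.assoc)
  qed
  then show ?thesis
    by (subst (1 2) cliff_expansion[of x])
      (simp add: sum_distrib_left sum_distrib_right cl_scale_mult)
qed

lemma cl_gamma_spin_gen: "cl_gen j = - (cl_gamma * spin_gen j)"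
  using exhaust_3[of j] by (auto simp: cl_gamma_def spin_gen_def cl_gen_normalize mult.assoc)

lemma cl_gamma_square: "cl_gamma * cl_gamma = 1"
  by (simp add: cl_gamma_def cl_gen_normalize mult.assoc)

lemma cl_gamma_central: "cl_gamma * x = x * cl_gamma"
proof (rule commute_cl_gen_imp_central)
  show "cl_gamma * cl_gen j = cl_gen j * cl_gamma" for j
    using exhaust_3[of j] by (auto simp: cl_gamma_def cl_gen_normalize mult.assoc)
qed


section \<open>Unit quaternions in the even Clifford algebra\<close>

definition quat_cl :: "real \<Rightarrow> real \<Rightarrow> real \<Rightarrow> real \<Rightarrow> 3 cliff" where
  "quat_cl a b c d =
    a *\<^sub>R 1 + b *\<^sub>R spin_gen 1 + c *\<^sub>R spin_gen 2 + d *\<^sub>R spin_gen 3"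

lemma quat_cl_mult:
  "quat_cl a b c d * quat_cl a' b' c' d' =
     quat_cl (a * a' - b * b' - c * c' - d * d') (a * b' + b * a' + c * d' - d * c')
       (a * c' - b * d' + c * a' + d * b') (a * d' + b * c' - c * b' + d * a')"
  by (simp add: quat_cl_def spin_gen_def cl_gen_normalize algebra_simps)

lemma quat_cl_1: "quat_cl 1 0 0 0 = 1"
  by (simp add: quat_cl_def)

lemma quat_cl_conj:
  assumes "a\<^sup>2 + b\<^sup>2 + c\<^sup>2 + d\<^sup>2 = 1"
  shows "quat_cl a b c d * quat_cl a (-b) (-c) (-d) = 1"
    "quat_cl a (-b) (-c) (-d) * quat_cl a b c d = 1"
  using assms by (simp_all add: quat_cl_mult quat_cl_1 power2_eq_square algebra_simps
      flip: quat_cl_1)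

lemma cl_vec_eq:
  "cl_vec \<mu> = \<mu> (su2E 1) *\<^sub>R cl_gen 1 + \<mu> (su2E 2) *\<^sub>R cl_gen 2 + \<mu> (su2E 3) *\<^sub>R cl_gen 3"
  by (simp add: cl_vec_def sum_3 scaleR_cliff_def)

text \<open>The product of two vectors is minus their inner product plus the bivector of their cross
  product.\<close>

lemma cl_vec_mult:
  "cl_vec \<mu> * cl_vec \<nu> = quat_cl (- su2_dual_inner \<mu> \<nu>)
     (\<mu> (su2E 2) * \<nu> (su2E 3) - \<mu> (su2E 3) * \<nu> (su2E 2))
     (\<mu> (su2E 3) * \<nu> (su2E 1) - \<mu> (su2E 1) * \<nu> (su2E 3))
     (\<mu> (su2E 1) * \<nu> (su2E 2) - \<mu> (su2E 2) * \<nu> (su2E 1))"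
  by (simp add: cl_vec_eq quat_cl_def spin_gen_def su2_dual_inner_def sum_3 cl_gen_normalize algebra_simps)

definition unit_quats :: "3 cliff set" where
  "unit_quats = {quat_cl a b c d | a b c d. a\<^sup>2 + b\<^sup>2 + c\<^sup>2 + d\<^sup>2 = 1}"

lemma unit_quats_mult:
  assumes "x \<in> unit_quats" "y \<in> unit_quats" shows "x * y \<in> unit_quats"
proof -
  obtain a b c d where x: "x = quat_cl a b c d" "a\<^sup>2 + b\<^sup>2 + c\<^sup>2 + d\<^sup>2 = 1"
    using assms(1) by (auto simp: unit_quats_def)
  obtain a' b' c' d' where y: "y = quat_cl a' b' c' d'" "a'\<^sup>2 + b'\<^sup>2 + c'\<^sup>2 + d'\<^sup>2 = 1"
    using assms(2) by (auto simp: unit_quats_def)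
  have "(a * a' - b * b' - c * c' - d * d')\<^sup>2 + (a * b' + b * a' + c * d' - d * c')\<^sup>2
      + (a * c' - b * d' + c * a' + d * b')\<^sup>2 + (a * d' + b * c' - c * b' + d * a')\<^sup>2
      = (a\<^sup>2 + b\<^sup>2 + c\<^sup>2 + d\<^sup>2) * (a'\<^sup>2 + b'\<^sup>2 + c'\<^sup>2 + d'\<^sup>2)"
    by algebra
  then show ?thesis
    unfolding x(1) y(1) quat_cl_mult using x(2) y(2) by (auto simp: unit_quats_def)
qed

text \<open>A product of two unit vectors is a unit quaternion by the identity of Lagrange
  $(\mu\cdot\nu)^2 + |\mu\times\nu|^2 = |\mu|^2|\nu|^2$, and unit quaternions form a group.\<close>

lemma Spin_subset_unit_quats: "x \<in> Spin \<Longrightarrow> x \<in> unit_quats"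
proof (induction rule: Spin.induct)
  case one
  have "\<exists>a b c d. 1 = quat_cl a b c d \<and> a\<^sup>2 + b\<^sup>2 + c\<^sup>2 + d\<^sup>2 = 1"
    by (rule exI[of _ 1], rule exI[of _ 0], rule exI[of _ 0], rule exI[of _ 0])
      (simp add: quat_cl_1)
  then show ?case by (simp add: unit_quats_def)
next
  case (gen \<mu> \<nu>)
  define m1 m2 m3 n1 n2 n3 where mn: "m1 = \<mu> (su2E 1)" "m2 = \<mu> (su2E 2)" "m3 = \<mu> (su2E 3)"
    "n1 = \<nu> (su2E 1)" "n2 = \<nu> (su2E 2)" "n3 = \<nu> (su2E 3)"
  have "m1\<^sup>2 + m2\<^sup>2 + m3\<^sup>2 = 1" "n1\<^sup>2 + n2\<^sup>2 + n3\<^sup>2 = 1"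
    using gen by (simp_all add: su2_dual_inner_def sum_3 mn power2_eq_square)
  moreover have "(- (m1 * n1 + m2 * n2 + m3 * n3))\<^sup>2 + (m2 * n3 - m3 * n2)\<^sup>2
      + (m3 * n1 - m1 * n3)\<^sup>2 + (m1 * n2 - m2 * n1)\<^sup>2
      = (m1\<^sup>2 + m2\<^sup>2 + m3\<^sup>2) * (n1\<^sup>2 + n2\<^sup>2 + n3\<^sup>2)"
    by algebra
  ultimately show ?case
    unfolding cl_vec_mult unit_quats_def
    by (auto simp: su2_dual_inner_def sum_3 simp flip: mn)
next
  case (mult x y)
  then show ?case by (simp add: unit_quats_mult)
next
  case (inv x y)
  obtain a b c d where x: "x = quat_cl a b c d" "a\<^sup>2 + b\<^sup>2 + c\<^sup>2 + d\<^sup>2 = 1"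
    using inv by (auto simp: unit_quats_def)
  have "y = y * (x * quat_cl a (-b) (-c) (-d))"
    using quat_cl_conj(1)[OF x(2)] by (simp add: x(1))
  also have "\<dots> = quat_cl a (-b) (-c) (-d)"
    using inv.hyps by (simp flip: mult.assoc)
  finally show ?case
    using x(2) unfolding unit_quats_def by (smt (verit) mem_Collect_eq power2_minus)
qed

lemma cl_inv_eqI:
  assumes "x * y = 1" "y * x = 1" shows "cl_inv x = y"
  unfolding cl_inv_def
proof (rule the_equality)
  show "x * y = 1 \<and> y * x = 1" using assms by simp
  fix z assume "x * z = 1 \<and> z * x = 1"
  then show "z = y" using assms by (metis mult.assoc mult_1 mult_1_right)
qed

text \<open>The commutators with $\epsilon_1$ and $\epsilon_2$ already detect all three imaginary
  coefficients. Without the restriction to even elements the centre would also contain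
  $\gamma$.\<close>

lemma quat_cl_central_imp_sign:
  assumes unit: "a\<^sup>2 + b\<^sup>2 + c\<^sup>2 + d\<^sup>2 = 1"
    and comm: "\<And>k. quat_cl a b c d * cl_gen k = cl_gen k * quat_cl a b c d"
  shows "quat_cl a b c d = 1 \<or> quat_cl a b c d = - 1"
proof -
  have 1: "quat_cl a b c d * cl_gen 1 - cl_gen 1 * quat_cl a b c d
      = (2 * d) *\<^sub>R cl_gen 2 - (2 * c) *\<^sub>R cl_gen 3"
    by (simp add: quat_cl_def spin_gen_def cl_gen_normalize algebra_simps flip: scaleR_2)
  have 2: "quat_cl a b c d * cl_gen 2 - cl_gen 2 * quat_cl a b c d
      = (2 * b) *\<^sub>R cl_gen 3 - (2 * d) *\<^sub>R cl_gen 1"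
    by (simp add: quat_cl_def spin_gen_def cl_gen_normalize algebra_simps flip: scaleR_2)
  have indep: "r = 0" "s = 0" if "r *\<^sub>R cl_gen j - s *\<^sub>R cl_gen k = (0 :: 3 cliff)" "j \<noteq> k"
    for r s j k
  proof -
    have "coeff (r *\<^sub>R cl_gen j - s *\<^sub>R cl_gen k :: 3 cliff) {i} = coeff 0 {i}" for i
      using that by simp
    from this[of j] this[of k] that(2) show "r = 0" "s = 0"
      by (simp_all add: scaleR_cliff_def cl_scale_def cl_gen_def cl_basis_def minus_cliff_def zero_cliff_def)
  qed
  have "b = 0" "c = 0" "d = 0"
    using indep[of "2 * d" 2 "2 * c" 3] indep[of "2 * b" 3 "2 * d" 1] 1 2 comm by auto
  moreover have "a = 1 \<or> a = -1"
    using unit calculation by (simp add: power2_eq_1_iff)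
  ultimately show ?thesis
    by (auto simp: quat_cl_def)
qed


section \<open>The group \<open>SU(2)\<close> as unit quaternions and its spin lift\<close>

definition quat_mat :: "real \<Rightarrow> real \<Rightarrow> real \<Rightarrow> real \<Rightarrow> complex^2^2" where
  "quat_mat a b c d =
    a *\<^sub>R mat 1 + b *\<^sub>R su2E 1 + c *\<^sub>R su2E 2 + d *\<^sub>R su2E 3"

lemma su2E_matrices:
  "su2E 1 = vector [vector [0, \<i>], vector [\<i>, 0]]"
  "su2E 2 = vector [vector [0, -1], vector [1, 0]]"
  "su2E 3 = vector [vector [\<i>, 0], vector [0, - \<i>]]"
  by (simp_all add: su2E_def)

lemma quat_mat_eq:
  "quat_mat a b c d =
    vector [vector [Complex a d, Complex (-c) b], vector [Complex c b, Complex a (-d)]]"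
  by (simp add: quat_mat_def su2E_matrices vec_eq_iff forall_2 mat_def complex_eq_iff)

lemma quat_mat_mult:
  "quat_mat a b c d ** quat_mat a' b' c' d' =
     quat_mat (a * a' - b * b' - c * c' - d * d') (a * b' + b * a' + c * d' - d * c')
       (a * c' - b * d' + c * a' + d * b') (a * d' + b * c' - c * b' + d * a')"
  by (simp add: quat_mat_eq vec_eq_iff forall_2 matrix_matrix_mult_def sum_2 complex_eq_iff algebra_simps)

lemma quat_mat_1: "quat_mat 1 0 0 0 = mat 1"
  by (simp add: quat_mat_def)

lemma quat_mat_conj:
  assumes "a\<^sup>2 + b\<^sup>2 + c\<^sup>2 + d\<^sup>2 = 1"
  shows "quat_mat a b c d ** quat_mat a (-b) (-c) (-d) = mat 1"
    "quat_mat a (-b) (-c) (-d) ** quat_mat a b c d = mat 1"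
  using assms by (simp_all add: quat_mat_mult quat_mat_1 power2_eq_square algebra_simps
      flip: quat_mat_1)

lemma quat_mat_SU2:
  assumes "a\<^sup>2 + b\<^sup>2 + c\<^sup>2 + d\<^sup>2 = 1"
  shows "quat_mat a b c d \<in> SU2"
proof -
  have "hadj (quat_mat a b c d) = quat_mat a (-b) (-c) (-d)"
    by (simp add: quat_mat_eq hadj_def vec_eq_iff forall_2 complex_eq_iff)
  moreover have "det (quat_mat a b c d) = of_real (a\<^sup>2 + b\<^sup>2 + c\<^sup>2 + d\<^sup>2)"
    by (simp add: quat_mat_eq det_2 complex_eq_iff power2_eq_square)
  ultimately show ?thesis
    using assms by (simp add: SU2_def unitary_mat_def quat_mat_conj)
qed

lemma quat_mat_inv:
  assumes "a\<^sup>2 + b\<^sup>2 + c\<^sup>2 + d\<^sup>2 = 1"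
  shows "matrix_inv (quat_mat a b c d) = quat_mat a (-b) (-c) (-d)"
proof -
  have "matrix_inv (quat_mat a b c d) ** quat_mat a b c d = mat 1"
    using quat_mat_conj[OF assms]
      someI_ex[of "\<lambda>B. quat_mat a b c d ** B = mat 1 \<and> B ** quat_mat a b c d = mat 1"]
    unfolding matrix_inv_def by blast
  then show ?thesis
    using quat_mat_conj(1)[OF assms] by (metis matrix_mul_assoc matrix_mul_lid matrix_mul_rid)
qed

lemma su2E_quat: "su2E 1 = quat_mat 0 1 0 0" "su2E 2 = quat_mat 0 0 1 0" "su2E 3 = quat_mat 0 0 0 1"
  by (simp_all add: quat_mat_def)

lemma su2_inner_quat:
  "su2_inner (quat_mat 0 b c d) (quat_mat a' b' c' d') = b * b' + c * c' + d * d'"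
  by (simp add: su2_inner_def quat_mat_mult) (simp add: quat_mat_eq trace_def sum_2 field_simps)

lemma su2_eps_in_dual: "su2_eps j \<in> su2_dual"
  by (auto simp: su2_dual_def su2_eps_def su2_inner_def matrix_add_ldistrib trace_add
      trace_def matrix_matrix_mult_def sum_2 algebra_simps)

lemma cl_vec_eps: "cl_vec (su2_eps j) = cl_gen j"
  using exhaust_3[of j] by (auto simp: cl_vec_eq su2_eps_def su2E_quat su2_inner_quat)

text \<open>With the inverses written as quaternion conjugates, the claim becomes
  $\mathrm{Cad}_x\epsilon_k = q\epsilon_k\bar q$, an identity between vectors whose coordinates
  are polynomials in $a, b, c, d$. It holds by expansion, for each \<open>k\<close> separately.\<close>

lemma quat_cl_implements_Cad:
  assumes "a\<^sup>2 + b\<^sup>2 + c\<^sup>2 + d\<^sup>2 = 1"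
  shows "cl_vec (Cad (quat_mat a b c d) (su2_eps k)) * quat_cl a b c d = quat_cl a b c d * cl_gen k"
proof -
  have inv2: "matrix_inv (quat_mat a (-b) (-c) (-d)) = quat_mat a b c d"
    using quat_mat_inv[of a "-b" "-c" "-d"] assms by simp
  \<comment> \<open>The simplifier merges equal scalars in one side only; this splits them again.\<close>
  have double: "(r * (s * 2)) *\<^sub>R y = (r * s) *\<^sub>R y + (r * s) *\<^sub>R y" for r s and y :: "3 cliff"
    by (metis mult.assoc mult_2_right distrib_left scaleR_add_left)
  have "cl_vec (Cad (quat_mat a b c d) (su2_eps k))
      = quat_cl a b c d * cl_gen k * quat_cl a (-b) (-c) (-d)"
    using exhaust_3[of k]
    by (elim disjE)
     (simp_all add: cl_vec_eq Cad_def Ad_def su2_eps_def quat_mat_inv[OF assms] inv2,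
      simp_all add: su2E_quat quat_mat_mult su2_inner_quat,
      simp_all add: quat_cl_def spin_gen_def cl_gen_normalize double algebra_simps)
  then show ?thesis
    by (simp add: mult.assoc quat_cl_conj[OF assms])
qed

text \<open>If \<open>q\<close> is the standard lift of \<open>x\<close>, then $q^{-1}h(x)$ commutes with all vectors because both
  \<open>q\<close> and \<open>h x\<close> implement the same rotation of them.\<close>

lemma Cad_hat_quat_up_to_sign:
  assumes "is_Cad_hat h" and u: "a\<^sup>2 + b\<^sup>2 + c\<^sup>2 + d\<^sup>2 = 1"
  shows "h (quat_mat a b c d) = quat_cl a b c d \<or> h (quat_mat a b c d) = - quat_cl a b c d"
proof -
  define x q q' where "x = quat_mat a b c d" and "q = quat_cl a b c d"
    and "q' = quat_cl a (-b) (-c) (-d)"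
  have x: "x \<in> SU2" unfolding x_def by (rule quat_mat_SU2[OF u])
  have hS: "h x \<in> unit_quats" using assms(1) x Spin_subset_unit_quats by (auto simp: is_Cad_hat_def)
  then obtain a' b' c' d' where h: "h x = quat_cl a' b' c' d'" "a'\<^sup>2 + b'\<^sup>2 + c'\<^sup>2 + d'\<^sup>2 = 1"
    by (auto simp: unit_quats_def)
  define p where "p = quat_cl a' (-b') (-c') (-d')"
  have p: "h x * p = 1" "p * h x = 1"
    using quat_cl_conj[OF h(2)] by (simp_all add: h(1) p_def)
  have inv: "cl_inv (h x) = p"
    by (rule cl_inv_eqI) (fact p)+
  have qq: "q * q' = 1" "q' * q = 1" by (simp_all add: q_def q'_def quat_cl_conj[OF u])
  have hc: "h x * cl_gen k = cl_vec (Cad x (su2_eps k)) * h x" for k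
  proof -
    have "h x * cl_vec (su2_eps k) * cl_inv (h x) = cl_vec (Cad x (su2_eps k))"
      using assms(1) x su2_eps_in_dual[of k] unfolding is_Cad_hat_def by blast
    then have "h x * cl_gen k * p = cl_vec (Cad x (su2_eps k))"
      by (simp only: inv cl_vec_eps)
    then have "h x * cl_gen k * (p * h x) = cl_vec (Cad x (su2_eps k)) * h x"
      by (metis mult.assoc)
    then show ?thesis by (simp add: p)
  qed
  have "q' * h x * cl_gen k = cl_gen k * (q' * h x)" for k
  proof -
    have "q' * h x * cl_gen k = q' * cl_vec (Cad x (su2_eps k)) * (q * q') * h x"
      by (simp add: qq hc mult.assoc)
    also have "\<dots> = q' * (cl_vec (Cad x (su2_eps k)) * q) * q' * h x"
      by (simp add: mult.assoc)
    also have "\<dots> = (q' * q) * cl_gen k * q' * h x"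
      using quat_cl_implements_Cad[OF u, of k] by (simp add: q_def x_def mult.assoc)
    finally show ?thesis by (simp add: qq mult.assoc)
  qed
  moreover have "q' * h x \<in> unit_quats"
  proof (rule unit_quats_mult[OF _ hS])
    have "a\<^sup>2 + (-b)\<^sup>2 + (-c)\<^sup>2 + (-d)\<^sup>2 = 1" using u by simp
    then show "q' \<in> unit_quats" unfolding q'_def unit_quats_def by blast
  qed
  ultimately have "q' * h x = 1 \<or> q' * h x = -1"
    unfolding unit_quats_def using quat_cl_central_imp_sign by fastforce
  then have "q * (q' * h x) = q \<or> q * (q' * h x) = - q" by auto
  then have "q * q' * h x = q \<or> q * q' * h x = - q" by (simp only: mult.assoc)
  then show ?thesis unfolding qq(1) mult_1 unfolding x_def q_def .
qed


section \<open>Exponentials and one-parameter groups\<close>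

lemma bounded_bilinear_matrix_mult:
  "bounded_bilinear ((**) :: complex^'n^'m \<Rightarrow> complex^'p^'n \<Rightarrow> complex^'p^'m)"
proof -
  have "bilinear ((**) :: complex^'n^'m \<Rightarrow> complex^'p^'n \<Rightarrow> complex^'p^'m)"
    by (auto simp: bilinear_def linear_iff matrix_add_ldistrib vec_eq_iff matrix_matrix_mult_def
        distrib_right distrib_left sum.distrib scaleR_sum_right)
  then show ?thesis by (simp add: bilinear_conv_bounded_bilinear)
qed

text \<open>Euler's formula: the even and odd powers of \<open>E\<close> are $\pm 1$ and $\pm E$, so the exponential
  series splits into the series of the cosine and the sine.\<close>

lemma mexp_square_minus_1:
  fixes E :: "complex^'n^'n"
  assumes "E ** E = - mat 1"
  shows "mexp (t *\<^sub>R E) = cos t *\<^sub>R mat 1 + sin t *\<^sub>R E"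
proof -
  interpret mm: bounded_bilinear "(**) :: complex^'n^'n \<Rightarrow> complex^'n^'n \<Rightarrow> complex^'n^'n"
    by (rule bounded_bilinear_matrix_mult)
  have pow: "((**) (t *\<^sub>R E) ^^ k) (mat 1) =
      (if even k then ((-1) ^ (k div 2) * t ^ k) *\<^sub>R mat 1
       else ((-1) ^ ((k - 1) div 2) * t ^ k) *\<^sub>R E)" for k
  proof (induction k)
    case (Suc k)
    then show ?case
      using assms by (auto simp: mm.scaleR_left mm.scaleR_right mm.minus_right elim!: oddE evenE)
  qed simp
  have "(1 / fact k) *\<^sub>R (((**) (t *\<^sub>R E) ^^ k) (mat 1))
      = (cos_coeff k *\<^sub>R t ^ k) *\<^sub>R mat 1 + (sin_coeff k *\<^sub>R t ^ k) *\<^sub>R E" for k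
    unfolding pow cos_coeff_def sin_coeff_def by (auto simp: field_simps)
  moreover have "(\<lambda>k. (cos_coeff k *\<^sub>R t ^ k) *\<^sub>R mat 1 + (sin_coeff k *\<^sub>R t ^ k) *\<^sub>R E)
      sums (cos t *\<^sub>R mat 1 + sin t *\<^sub>R E)"
    by (intro sums_add sums_scaleR_left cos_converges sin_converges)
  ultimately show ?thesis
    by (simp add: mexp_def sums_iff)
qed

lemma su2E_square: "su2E j ** su2E j = - mat 1"
  using exhaust_3[of j] by (auto simp: su2E_quat quat_mat_mult) (simp_all add: quat_mat_def flip: scaleR_minus_left)

lemma mexp_su2E: "mexp (t *\<^sub>R su2E j) = cos t *\<^sub>R mat 1 + sin t *\<^sub>R su2E j"
  by (rule mexp_square_minus_1[OF su2E_square])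

lemma mexp_su2E_add: "mexp ((s + t) *\<^sub>R su2E j) = mexp (s *\<^sub>R su2E j) ** mexp (t *\<^sub>R su2E j)"
proof -
  interpret mm: bounded_bilinear "(**) :: complex^2^2 \<Rightarrow> complex^2^2 \<Rightarrow> complex^2^2"
    by (rule bounded_bilinear_matrix_mult)
  show ?thesis
    unfolding mexp_su2E cos_add sin_add
    by (simp add: mm.add_left mm.add_right mm.scaleR_left mm.scaleR_right su2E_square algebra_simps)
qed

text \<open>A quaternion presentation that covers the three coordinate directions at once: the exponential
  and its spin lift have the same four coefficients.\<close>

lemma mexp_su2E_quat:
  obtains a b c d where "a\<^sup>2 + b\<^sup>2 + c\<^sup>2 + d\<^sup>2 = 1" "mexp (t *\<^sub>R su2E j) = quat_mat a b c d"
    "cos t *\<^sub>R 1 + sin t *\<^sub>R spin_gen j = quat_cl a b c d"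
proof -
  consider "j = 1" | "j = 2" | "j = 3" using exhaust_3 by blast
  then show ?thesis
  proof cases
    case 1 then show ?thesis
      by (intro that[of "cos t" "sin t" 0 0]) (simp_all add: mexp_su2E quat_mat_def quat_cl_def)
  next
    case 2 then show ?thesis
      by (intro that[of "cos t" 0 "sin t" 0]) (simp_all add: mexp_su2E quat_mat_def quat_cl_def)
  next
    case 3 then show ?thesis
      by (intro that[of "cos t" 0 0 "sin t"]) (simp_all add: mexp_su2E quat_mat_def quat_cl_def)
  qed
qed

lemma mexp_su2E_in_SU2: "mexp (t *\<^sub>R su2E j) \<in> SU2"
  by (metis mexp_su2E_quat quat_mat_SU2)

text \<open>The sign left open for a single group element squares away, because each element of a
  one-parameter group is a square in it.\<close>

lemma Cad_hat_mexp:
  assumes "is_Cad_hat h"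
  shows "h (mexp (t *\<^sub>R su2E j)) = cos t *\<^sub>R 1 + sin t *\<^sub>R spin_gen j"
proof -
  define x where "x s = mexp (s *\<^sub>R su2E j)" for s
  \<comment> \<open>\<open>g\<close> is the standard lift of the one-parameter group \<open>x\<close>.\<close>
  define g where "g s = cos s *\<^sub>R 1 + sin s *\<^sub>R spin_gen j" for s
  have "h (x (t / 2)) = g (t / 2) \<or> h (x (t / 2)) = - g (t / 2)"
    by (rule mexp_su2E_quat[of "t / 2" j])
      (simp add: x_def g_def Cad_hat_quat_up_to_sign[OF assms])
  then have sq: "h (x (t / 2)) * h (x (t / 2)) = g (t / 2) * g (t / 2)"
    by auto
  have "x t = x (t / 2) ** x (t / 2)"
    using mexp_su2E_add[of "t / 2" "t / 2" j] by (simp add: x_def)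
  then have "h (x t) = h (x (t / 2)) * h (x (t / 2))"
    using assms mexp_su2E_in_SU2[of "t / 2" j] by (simp add: is_Cad_hat_def x_def)
  also have "\<dots> = (cos (t / 2) * cos (t / 2) - sin (t / 2) * sin (t / 2)) *\<^sub>R 1
      + (sin (t / 2) * cos (t / 2) + cos (t / 2) * sin (t / 2)) *\<^sub>R spin_gen j"
    unfolding sq g_def
    by (simp add: spin_gen_square algebra_simps) (simp only: mult_2 scaleR_add_left)
  also have "\<dots> = g t"
    unfolding g_def cos_add[symmetric] sin_add[symmetric] by simp
  finally show ?thesis by (simp add: x_def g_def)
qed

lemma has_vector_derivative_translate:
  fixes f :: "real \<Rightarrow> 'a::real_normed_vector"
  assumes "(f has_vector_derivative d) (at (t + s))"
  shows "((\<lambda>s. f (t + s)) has_vector_derivative d) (at s)"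
proof -
  have "((+) t has_vector_derivative 1) (at s)"
    by (auto simp flip: has_real_derivative_iff_has_vector_derivative intro!: derivative_eq_intros)
  from vector_diff_chain_at[OF this assms] show ?thesis
    by (simp add: o_def)
qed

text \<open>The integral $M_t = \int_t^{t+a} V$ is differentiable in $t$, and it equals $V(t) M_0$. For
  small $a > 0$ the matrix $M_0$ is invertible, since $M_0/a$ tends to the identity. Thus
  $V(t) = M_t M_0^{-1}$ is differentiable.\<close>

lemma continuous_one_parameter_group_differentiable:
  fixes V :: "real \<Rightarrow> complex^'n^'n"
  assumes cont: "continuous_on UNIV V" and add: "\<And>s t. V (s + t) = V s ** V t" and zero: "V 0 = mat 1"
  shows "\<exists>A. (V has_vector_derivative A) (at 0)"
proof -
  interpret mm: bounded_bilinear "(**) :: complex^'n^'n \<Rightarrow> complex^'n^'n \<Rightarrow> complex^'n^'n"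
    by (rule bounded_bilinear_matrix_mult)
  \<comment> \<open>The base point $-1$ makes the antiderivative differentiable on both sides of $0$.\<close>
  define F where "F t = integral {-1..t} V" for t
  have F': "(F has_vector_derivative V t) (at t)" if "-1 < t" for t
  proof -
    have "(F has_vector_derivative V t) (at t within {-1..t+1})"
      unfolding F_def using that
      by (intro integral_has_vector_derivative continuous_on_subset[OF cont]) auto
    then show ?thesis
      using that by (simp add: at_within_Icc_at)
  qed
  \<comment> \<open>The difference quotient of \<open>F\<close> at $0$ tends to the identity, so it is invertible near $0$.\<close>
  define G where "G a = (1 / a) *\<^sub>R (F a - F 0)" for a
  have "(G \<longlongrightarrow> mat 1) (at 0)"
    unfolding tendsto_iff eventually_at
  proof (intro allI impI)
    fix e :: real assume "e > 0"
    then obtain d where d: "d > 0"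
      "\<And>x. x \<noteq> 0 \<Longrightarrow> \<bar>x\<bar> < d \<Longrightarrow> norm (F x - F 0 - x *\<^sub>R mat 1) / \<bar>x\<bar> < e"
      using F'[of 0] by (auto simp: has_vector_derivative_def zero has_derivative_at')
    have "dist (G x) (mat 1) < e" if "x \<noteq> 0" "\<bar>x\<bar> < d" for x
    proof -
      have "G x - mat 1 = (1 / x) *\<^sub>R (F x - F 0 - x *\<^sub>R mat 1)"
        using that by (simp add: G_def scaleR_right_diff_distrib)
      then show ?thesis
        using d(2)[OF that] by (simp add: dist_norm)
    qed
    with d(1) show "\<exists>d>0. \<forall>x\<in>UNIV. x \<noteq> 0 \<and> dist x 0 < d \<longrightarrow> dist (G x) (mat 1) < e"
      by auto
  qed
  then have "(G \<longlongrightarrow> mat 1) (at_right 0)"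
    by (rule Lim_at_imp_Lim_at_within)
  then have "((\<lambda>a. det (G a)) \<longlongrightarrow> det (mat 1 :: complex^'n^'n)) (at_right 0)"
    unfolding det_def
    by (intro tendsto_sum tendsto_mult tendsto_prod tendsto_const tendsto_vec_nth)
  then have "\<forall>\<^sub>F a in at_right 0. det (G a) \<noteq> 0"
    by (rule tendsto_imp_eventually_ne) simp
  then have "\<forall>\<^sub>F a in at_right 0. det (G a) \<noteq> 0 \<and> a > 0"
    by (intro eventually_conj eventually_at_right_less)
  then have "\<exists>a. det (G a) \<noteq> 0 \<and> a > 0"
    by (rule eventually_happens'[rotated]) simp
  then obtain a where a: "a > 0" "invertible (G a)"
    by (auto simp: invertible_det_nz)
  then obtain N where "G a ** N = mat 1"
    by (auto simp: invertible_def)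
  then have N: "(F a - F 0) ** ((1 / a) *\<^sub>R N) = mat 1"
    by (simp add: G_def mm.scaleR_left mm.scaleR_right)
  have "V t = (F (t + a) - F t) ** ((1 / a) *\<^sub>R N)" if "-1 < t" for t
  proof -
    have VF: "((\<lambda>s. V t ** F s) has_vector_derivative V t ** V s) (at s)" if "-1 < s" for s
      by (rule bounded_linear.has_vector_derivative[OF mm.bounded_linear_right F'[OF that]])
    have Fs: "((\<lambda>s. F (t + s)) has_vector_derivative V t ** V s) (at s)" if "0 \<le> s" for s
      using has_vector_derivative_translate[OF F'[of "t + s"]] that \<open>-1 < t\<close> by (simp add: add)
    have "((\<lambda>s. V t ** V s) has_integral V t ** F a - V t ** F 0) {0..a}"
      using a VF by (intro fundamental_theorem_of_calculus) (auto intro: has_vector_derivative_at_within)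
    moreover have "((\<lambda>s. V t ** V s) has_integral F (t + a) - F (t + 0)) {0..a}"
      using a Fs by (intro fundamental_theorem_of_calculus[where f = "\<lambda>s. F (t + s)"])
       (auto intro: has_vector_derivative_at_within)
    ultimately have "V t ** (F a - F 0) = F (t + a) - F t"
      by (auto simp: mm.diff_right dest: has_integral_unique)
    then have "(F (t + a) - F t) ** ((1 / a) *\<^sub>R N) = V t ** ((F a - F 0) ** ((1 / a) *\<^sub>R N))"
      by (simp add: matrix_mul_assoc)
    then show ?thesis
      by (simp only: N matrix_mul_rid)
  qed
  moreover have "((\<lambda>t. (F (t + a) - F t) ** ((1 / a) *\<^sub>R N)) has_vector_derivative
      (V a - V 0) ** ((1 / a) *\<^sub>R N)) (at 0)"
  proof (rule bounded_linear.has_vector_derivative[OF mm.bounded_linear_left has_vector_derivative_diff])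
    show "((\<lambda>t. F (t + a)) has_vector_derivative V a) (at 0)"
      using has_vector_derivative_translate[of F "V a" a 0] F'[of a] a by (simp add: add.commute)
    show "(F has_vector_derivative V 0) (at 0)"
      by (rule F') simp
  qed
  ultimately have "(V has_vector_derivative (V a - V 0) ** ((1 / a) *\<^sub>R N)) (at 0)"
    by (intro has_vector_derivative_transform_within_open[where S = "{-1<..}" and g = V]) auto
  then show ?thesis ..
qed


section \<open>The chirality of an irreducible Clifford representation\<close>

lemma cscale_of_real: "cscale (of_real r) M = r *\<^sub>R M"
  by (simp add: cscale_def map_matrix_def vec_eq_iff) (simp add: scaleR_conv_of_real)

lemma matrix_vector_mult_minus_left: "(- A) *v x = - (A *v x)" for A :: "'a::comm_ring_1^'n^'m"
  by (simp add: vec_eq_iff matrix_vector_mult_def sum_negf)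

text \<open>Since $\gamma$ is central, the eigenspace of $\kappa(\gamma)$ for the eigenvalue $1$ is
  invariant, hence everything or zero. It contains all $(\kappa(\gamma) + 1)w$ because
  $\gamma^2 = 1$; if it is zero, then $\kappa(\gamma) = -1$.\<close>

lemma cliff_rep_gamma:
  assumes "irreducible_cliff_star_rep \<kappa>"
  shows "\<kappa> cl_gamma = mat 1 \<or> \<kappa> cl_gamma = - mat 1"
proof -
  have m: "\<kappa> (x * y) = \<kappa> x ** \<kappa> y" and one: "\<kappa> 1 = mat 1" and irr: "irreducible_mats (range \<kappa>)" for x y
    using assms by (auto simp: irreducible_cliff_star_rep_def)
  define W where "W = {w. \<kappa> cl_gamma *v w = w}"
  have gg: "\<kappa> cl_gamma *v (\<kappa> cl_gamma *v w) = w" for w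
    by (simp add: matrix_vector_mul_assoc one cl_gamma_square flip: m)
  have "vec.subspace W"
    by (auto simp: W_def vec.subspace_def matrix_vector_right_distrib vector_scalar_commute)
  moreover have "\<kappa> x *v w \<in> W" if "w \<in> W" for x w
  proof -
    have "\<kappa> cl_gamma *v (\<kappa> x *v w) = \<kappa> x *v (\<kappa> cl_gamma *v w)"
      by (simp add: matrix_vector_mul_assoc cl_gamma_central flip: m)
    then show ?thesis using that by (simp add: W_def)
  qed
  ultimately have "W = {0} \<or> W = UNIV"
    using irr by (auto simp: irreducible_mats_def)
  then show ?thesis
  proof
    assume W: "W = {0}"
    have "\<kappa> cl_gamma *v w = (- mat 1) *v w" for w
    proof -
      have "\<kappa> cl_gamma *v w + w \<in> W"
        by (simp add: W_def matrix_vector_right_distrib gg)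
      then show ?thesis
        using W by (simp add: eq_neg_iff_add_eq_0 matrix_vector_mult_minus_left)
    qed
    then show ?thesis by (simp add: matrix_eq)
  next
    assume "W = UNIV"
    then show ?thesis by (auto simp: W_def matrix_eq)
  qed
qed

lemma cliff_rep_gen_gamma:
  assumes "irreducible_cliff_star_rep \<kappa>"
  shows "\<kappa> (cl_gen j) = - (\<kappa> cl_gamma ** \<kappa> (spin_gen j))"
proof -
  have add: "\<kappa> (x + y) = \<kappa> x + \<kappa> y" and mult: "\<kappa> (x * y) = \<kappa> x ** \<kappa> y" for x y
    using assms by (auto simp: irreducible_cliff_star_rep_def)
  interpret \<kappa>: Modules.additive \<kappa> by unfold_locales (rule add)
  show ?thesis
    by (subst cl_gamma_spin_gen) (simp add: \<kappa>.minus mult)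
qed


section \<open>Operators on the tensor product\<close>

lemma bounded_bilinear_tensor: "bounded_bilinear tensor"
proof -
  have "bilinear tensor"
    by (auto simp: bilinear_def linear_iff tensor_def cscale_def map_matrix_def vec_eq_iff algebra_simps)
  then show ?thesis by (simp add: bilinear_conv_bounded_bilinear)
qed

interpretation tensor: bounded_bilinear tensor
  by (rule bounded_bilinear_tensor)

lemma op_tensor_sum_left: "op_tensor (\<lambda>T. \<Sum>i\<in>I. A i T) K v = (\<Sum>i\<in>I. op_tensor (A i) K v)"
  by (simp add: op_tensor_def tensor.sum_left) (rule sum.swap)

lemma op_tensor_sum_right: "op_tensor A (\<lambda>\<psi>. \<Sum>i\<in>I. K i \<psi>) v = (\<Sum>i\<in>I. op_tensor A (K i) v)"
  by (simp add: op_tensor_def tensor.sum_right) (rule sum.swap)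

lemma op_tensor_minus_right: "op_tensor A (\<lambda>\<psi>. - K \<psi>) v = - op_tensor A K v"
  by (simp add: op_tensor_def tensor.minus_right sum_negf)

text \<open>Commuting with complex scalars is what makes \<open>op_tensor\<close> multiplicative, since the entries
  of the second factor enter as scalars.\<close>

definition clinear_mat :: "(complex^'n^'m \<Rightarrow> complex^'n^'m) \<Rightarrow> bool" where
  "clinear_mat A \<longleftrightarrow> (\<forall>S T. A (S + T) = A S + A T) \<and> (\<forall>c T. A (cscale c T) = cscale c (A T))"

lemma clinear_mat_sum:
  assumes "clinear_mat A" shows "A (\<Sum>i\<in>I. f i) = (\<Sum>i\<in>I. A (f i))"
proof -
  interpret Modules.additive A using assms by unfold_locales (simp add: clinear_mat_def)
  show ?thesis by (rule sum)
qed

lemma op_tensor_add_arg: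
  "clinear_mat A \<Longrightarrow> op_tensor A K (v + w) = op_tensor A K v + op_tensor A K w"
  by (simp add: op_tensor_def clinear_mat_def tensor.add_left sum.distrib)

lemma op_tensor_nth: "op_tensor A ((*v) k) v $ i = (\<Sum>j\<in>UNIV. cscale (k $ i $ j) (A (v $ j)))"
proof -
  have "(k *v axis j 1) $ i = k $ i $ j" for j
    by (simp add: matrix_vector_mult_def axis_def if_distrib cong: if_cong)
  then show ?thesis by (simp add: op_tensor_def tensor_def)
qed

lemma cscale_algebra:
  "cscale c (S + T) = cscale c S + cscale c T" "cscale c (cscale d T) = cscale (c * d) T"
  "cscale (\<Sum>i\<in>I. f i) T = (\<Sum>i\<in>I. cscale (f i) T)"
  "cscale c (\<Sum>i\<in>I. g i) = (\<Sum>i\<in>I. cscale c (g i))"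
  by (simp_all add: cscale_def map_matrix_def vec_eq_iff algebra_simps sum_distrib_left sum_distrib_right)

lemma op_tensor_compose:
  assumes "clinear_mat A"
  shows "op_tensor A ((*v) k) (op_tensor B ((*v) l) v) = op_tensor (\<lambda>T. A (B T)) ((*v) (k ** l)) v"
proof -
  have "op_tensor A ((*v) k) (op_tensor B ((*v) l) v) $ i
      = op_tensor (\<lambda>T. A (B T)) ((*v) (k ** l)) v $ i" for i
  proof -
    have "op_tensor A ((*v) k) (op_tensor B ((*v) l) v) $ i =
        (\<Sum>j\<in>UNIV. \<Sum>m\<in>UNIV. cscale (k $ i $ j * l $ j $ m) (A (B (v $ m))))"
      using assms by (simp add: op_tensor_nth clinear_mat_sum[OF assms] cscale_algebra)
        (simp add: clinear_mat_def cscale_algebra)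
    also have "\<dots> = (\<Sum>m\<in>UNIV. \<Sum>j\<in>UNIV. cscale (k $ i $ j * l $ j $ m) (A (B (v $ m))))"
      by (rule sum.swap)
    also have "\<dots> = op_tensor (\<lambda>T. A (B T)) ((*v) (k ** l)) v $ i"
      by (simp add: op_tensor_nth matrix_matrix_mult_def cscale_algebra)
    finally show ?thesis .
  qed
  then show ?thesis by (simp add: vec_eq_iff)
qed

lemma id_matrix: "id = (*v) (mat 1 :: complex^'n^'n)"
  by (auto simp: fun_eq_iff)

text \<open>The mixed terms agree because \<open>L\<close> and \<open>k\<close> act on different tensor factors.\<close>

lemma op_tensor_square_of_sum:
  fixes v :: "complex^'n^'n^'s" and k :: "complex^'s^'s"
  assumes "clinear_mat L"
  defines "X \<equiv> \<lambda>v :: complex^'n^'n^'s. op_tensor L id v + op_tensor id ((*v) k) v"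
  shows "X (X v) = op_tensor (\<lambda>T. L (L T)) id v + op_tensor id (\<lambda>\<psi>. k *v (k *v \<psi>)) v
    + 2 *\<^sub>R op_tensor L ((*v) k) v"
proof -
  have id: "clinear_mat (\<lambda>T. T)" by (simp add: clinear_mat_def)
  have X: "X v = op_tensor L ((*v) (mat 1)) v + op_tensor (\<lambda>T. T) ((*v) k) v" for v
    by (simp add: X_def id_matrix[symmetric]) (simp add: id_def)
  have kk: "(\<lambda>\<psi>. k *v (k *v \<psi>)) = (*v) (k ** k)"
    by (simp add: fun_eq_iff matrix_vector_mul_assoc)
  have i: "(id :: complex^'n^'n \<Rightarrow> _) = (\<lambda>T. T)" by (simp add: id_def)
  show ?thesis
    unfolding X op_tensor_add_arg[OF id] op_tensor_add_arg[OF assms(1)]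
      op_tensor_compose[OF id] op_tensor_compose[OF assms(1)] kk
    by (simp add: scaleR_2 i) (simp add: id_matrix)
qed

text \<open>The product rule for tensors; at the base point both factors are the identity, which is why
  each summand retains only one derivative.\<close>

lemma op_tensor_has_vector_derivative:
  assumes "\<And>T. ((\<lambda>t. a t T) has_vector_derivative a' T) (at t0)"
    and "\<And>\<psi>. ((\<lambda>t. s t \<psi>) has_vector_derivative s' \<psi>) (at t0)"
    and "a t0 = id" "s t0 = id"
  shows "((\<lambda>t. op_tensor (a t) (s t) v) has_vector_derivative
    (op_tensor a' id v + op_tensor id s' v)) (at t0)"
proof -
  have "((\<lambda>t. tensor (a t (v $ j)) (s t (axis j 1))) has_vector_derivative
      (tensor (a t0 (v $ j)) (s' (axis j 1)) + tensor (a' (v $ j)) (s t0 (axis j 1)))) (at t0)" for j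
    by (rule tensor.has_vector_derivative[OF assms(1,2)])
  from has_vector_derivative_sum[of UNIV, OF this] show ?thesis
    by (simp add: op_tensor_def assms(3,4) sum.distrib add.commute)
qed


section \<open>The Casimir operator of the tensor product\<close>

lemma bounded_linear_hadj: "bounded_linear (hadj :: complex^'n^'m \<Rightarrow> complex^'m^'n)"
proof -
  have "linear (hadj :: complex^'n^'m \<Rightarrow> complex^'m^'n)"
    by (auto simp: linear_iff hadj_def vec_eq_iff)
  then show ?thesis by (simp add: linear_conv_bounded_linear)
qed

lemma hadj_one: "hadj (mat 1) = mat 1"
  by (auto simp: hadj_def mat_def vec_eq_iff)

lemma unitary_rep_one:
  assumes "irreducible_unitary_rep U"
  shows "U (mat 1) = mat 1"
proof -
  have I: "mat 1 \<in> SU2"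
    using quat_mat_SU2[of 1 0 0 0] by (simp add: quat_mat_1)
  then have "hadj (U (mat 1)) ** U (mat 1) = mat 1"
    using assms by (auto simp: irreducible_unitary_rep_def unitary_mat_def)
  moreover have "U (mat 1) ** U (mat 1) = U (mat 1)"
    using assms I by (metis irreducible_unitary_rep_def matrix_mul_lid)
  ultimately show ?thesis
    by (metis matrix_mul_assoc matrix_mul_lid)
qed

lemma mexp_su2E_0: "mexp (0 *\<^sub>R su2E j) = mat 1"
  by (simp only: mexp_su2E) simp

lemma unitary_rep_differentiable:
  assumes "irreducible_unitary_rep U"
  shows "\<exists>A. ((\<lambda>t. U (mexp (t *\<^sub>R su2E j))) has_vector_derivative A) (at 0)"
proof (rule continuous_one_parameter_group_differentiable)
  show "continuous_on UNIV (\<lambda>t. U (mexp (t *\<^sub>R su2E j)))"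
  proof (rule continuous_on_compose2[of SU2 U])
    show "continuous_on SU2 U" using assms by (simp add: irreducible_unitary_rep_def)
    show "continuous_on UNIV (\<lambda>t. mexp (t *\<^sub>R su2E j))"
      unfolding mexp_su2E by (intro continuous_intros)
  qed (auto simp: mexp_su2E_in_SU2)
  show "U (mexp ((s + t) *\<^sub>R su2E j)) = U (mexp (s *\<^sub>R su2E j)) ** U (mexp (t *\<^sub>R su2E j))" for s t
    using assms by (simp add: irreducible_unitary_rep_def mexp_su2E_add mexp_su2E_in_SU2)
  show "U (mexp (0 *\<^sub>R su2E j)) = mat 1"
    by (simp only: mexp_su2E_0 unitary_rep_one[OF assms])
qed

text \<open>If $A$ is the derivative of \<open>U\<close> in the direction $E_j$, then the derivative of the conjugation
  action is $L(T) = AT + TA^*$.\<close>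

lemma conj_action_has_vector_derivative:
  fixes U :: "complex^2^2 \<Rightarrow> complex^'h^'h"
  assumes "irreducible_unitary_rep U"
  obtains L where "clinear_mat L"
    "\<And>T. ((\<lambda>t. conj_action U (mexp (t *\<^sub>R su2E j)) T) has_vector_derivative L T) (at 0)"
proof -
  interpret mm: bounded_bilinear "(**) :: complex^'h^'h \<Rightarrow> complex^'h^'h \<Rightarrow> complex^'h^'h"
    by (rule bounded_bilinear_matrix_mult)
  obtain A where A: "((\<lambda>t. U (mexp (t *\<^sub>R su2E j))) has_vector_derivative A) (at 0)"
    using unitary_rep_differentiable[OF assms] by blast
  have U0: "U (mexp (0 *\<^sub>R su2E j)) = mat 1"
    by (simp only: mexp_su2E_0 unitary_rep_one[OF assms])
  have cs: "cscale c S ** T = cscale c (S ** T)" "S ** cscale c T = cscale c (S ** T)"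
    for c and S T :: "complex^'h^'h"
    by (simp_all add: cscale_def map_matrix_def matrix_matrix_mult_def vec_eq_iff sum_distrib_left mult_ac)
  show ?thesis
  proof
    show "clinear_mat (\<lambda>T. T ** hadj A + A ** T)"
      by (simp add: clinear_mat_def mm.add_left mm.add_right cs cscale_algebra)
    fix T
    show "((\<lambda>t. conj_action U (mexp (t *\<^sub>R su2E j)) T) has_vector_derivative (T ** hadj A + A ** T)) (at 0)"
      using mm.has_vector_derivative[OF bounded_linear.has_vector_derivative[OF mm.bounded_linear_left A, of T]
          bounded_linear.has_vector_derivative[OF bounded_linear_hadj A]]
      unfolding U0 conj_action_def hadj_one by simp
  qed
qed

lemma infinitesimal_eqI:
  "((\<lambda>t. \<pi> (mexp (t *\<^sub>R X)) v) has_vector_derivative d) (at 0) \<Longrightarrow> infinitesimal \<pi> X v = d"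
  unfolding infinitesimal_def by (rule vector_derivative_at)

lemma scaleR_matrix_vector_mult: "(r *\<^sub>R A) *v x = r *\<^sub>R (A *v x)" for A :: "complex^'n^'m"
  by (simp add: vec_eq_iff matrix_vector_mult_def scaleR_sum_right)

lemma spin_rep_has_vector_derivative:
  assumes "irreducible_cliff_star_rep \<kappa>" and "is_Cad_hat h"
  shows "((\<lambda>t. spin_rep \<kappa> h (mexp (t *\<^sub>R su2E j)) \<psi>) has_vector_derivative
    \<kappa> (spin_gen j) *v \<psi>) (at 0)"
proof -
  have "spin_rep \<kappa> h (mexp (t *\<^sub>R su2E j)) \<psi> = cos t *\<^sub>R \<psi> + sin t *\<^sub>R (\<kappa> (spin_gen j) *v \<psi>)" for t
    using assms(1) unfolding spin_rep_def Cad_hat_mexp[OF assms(2)]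
    by (simp add: irreducible_cliff_star_rep_def scaleR_cliff_def cscale_of_real
        matrix_vector_mult_add_rdistrib scaleR_matrix_vector_mult)
  moreover have "((\<lambda>t. cos t *\<^sub>R \<psi> + sin t *\<^sub>R (\<kappa> (spin_gen j) *v \<psi>)) has_vector_derivative
      (- sin 0 *\<^sub>R \<psi> + cos 0 *\<^sub>R (\<kappa> (spin_gen j) *v \<psi>))) (at 0)"
    by (auto intro!: derivative_eq_intros simp flip: has_real_derivative_iff_has_vector_derivative)
  ultimately show ?thesis by simp
qed

text \<open>The squares of $\alpha_{E_j} \otimes I$ and $I \otimes \sigma_{E_j}$ cancel against the two
  Casimir operators that are subtracted, and only twice the mixed terms remain.\<close>

lemma casimir_tensor_rep:
  fixes U :: "complex^2^2 \<Rightarrow> complex^'h^'h" and \<kappa> :: "3 cliff \<Rightarrow> complex^'s^'s"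
  assumes U: "irreducible_unitary_rep U" and \<kappa>: "irreducible_cliff_star_rep \<kappa>" and h: "is_Cad_hat h"
  shows "casimir (tensor_rep (conj_action U) (spin_rep \<kappa> h)) v
      - op_tensor (casimir (conj_action U)) id v - op_tensor id (casimir (spin_rep \<kappa> h)) v
    = 2 *\<^sub>R (\<Sum>j\<in>UNIV. op_tensor (infinitesimal (conj_action U) (su2E j)) ((*v) (\<kappa> (spin_gen j))) v)"
proof -
  define L where "L j = infinitesimal (conj_action U) (su2E j)" for j
  have L: "clinear_mat (L j)" and
    L': "((\<lambda>t. conj_action U (mexp (t *\<^sub>R su2E j)) T) has_vector_derivative L j T) (at 0)" for j T
  proof -
    obtain M where M: "clinear_mat M"
      "\<And>T. ((\<lambda>t. conj_action U (mexp (t *\<^sub>R su2E j)) T) has_vector_derivative M T) (at 0)"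
      using conj_action_has_vector_derivative[OF U] by blast
    then have "L j = M"
      unfolding L_def by (intro ext infinitesimal_eqI)
    then show "clinear_mat (L j)"
      "((\<lambda>t. conj_action U (mexp (t *\<^sub>R su2E j)) T) has_vector_derivative L j T) (at 0)"
      using M by auto
  qed
  note \<sigma>' = spin_rep_has_vector_derivative[OF \<kappa> h]
  have \<sigma>: "infinitesimal (spin_rep \<kappa> h) (su2E j) = (*v) (\<kappa> (spin_gen j))" for j
    by (intro ext infinitesimal_eqI \<sigma>')
  have \<alpha>0: "conj_action U (mexp (0 *\<^sub>R su2E j)) = id" for j
    unfolding mexp_su2E_0 by (simp add: fun_eq_iff conj_action_def unitary_rep_one[OF U] hadj_one)
  have \<sigma>0: "spin_rep \<kappa> h (mexp (0 *\<^sub>R su2E j)) = id" for j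
    unfolding spin_rep_def Cad_hat_mexp[OF h] using \<kappa> by (simp add: irreducible_cliff_star_rep_def id_matrix)
  have X: "infinitesimal (tensor_rep (conj_action U) (spin_rep \<kappa> h)) (su2E j) w
      = op_tensor (L j) id w + op_tensor id ((*v) (\<kappa> (spin_gen j))) w" for j w
    unfolding tensor_rep_def
    by (intro infinitesimal_eqI op_tensor_has_vector_derivative L' \<sigma>' \<alpha>0 \<sigma>0)
  have "casimir (tensor_rep (conj_action U) (spin_rep \<kappa> h)) v =
      (\<Sum>j\<in>UNIV. op_tensor (\<lambda>T. L j (L j T)) id v
        + op_tensor id (\<lambda>\<psi>. \<kappa> (spin_gen j) *v (\<kappa> (spin_gen j) *v \<psi>)) v
        + 2 *\<^sub>R op_tensor (L j) ((*v) (\<kappa> (spin_gen j))) v)"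
    unfolding casimir_def X op_tensor_square_of_sum[OF L] ..
  moreover have "casimir (conj_action U) = (\<lambda>T. \<Sum>j\<in>UNIV. L j (L j T))"
    "casimir (spin_rep \<kappa> h) = (\<lambda>\<psi>. \<Sum>j\<in>UNIV. \<kappa> (spin_gen j) *v (\<kappa> (spin_gen j) *v \<psi>))"
    by (simp_all add: fun_eq_iff casimir_def L_def \<sigma>)
  ultimately show ?thesis
    by (simp add: op_tensor_sum_left op_tensor_sum_right sum.distrib scaleR_sum_right flip: L_def)
qed

theorem theorem9p2:
  fixes n :: nat
    and U :: "complex^2^2 \<Rightarrow> complex^'h^'h"
    and \<kappa> :: "3 cliff \<Rightarrow> complex^2^2"
    and Cad_hat :: "complex^2^2 \<Rightarrow> 3 cliff"
    and \<alpha> :: "complex^2^2 \<Rightarrow> complex^'h^'h \<Rightarrow> complex^'h^'h"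
    and \<sigma> :: "complex^2^2 \<Rightarrow> complex^2 \<Rightarrow> complex^2"
    and \<sigma>' :: "complex^2^2 \<Rightarrow> complex^'h^'h^2 \<Rightarrow> complex^'h^'h^2"
  assumes "irreducible_unitary_rep U" and "has_highest_weight U n"
    and "irreducible_cliff_star_rep \<kappa>"
    and "is_Cad_hat Cad_hat"
  defines "\<alpha> \<equiv> conj_action U"
    and "\<sigma> \<equiv> spin_rep \<kappa> Cad_hat"
    and "\<sigma>' \<equiv> tensor_rep \<alpha> \<sigma>"
  shows "(\<kappa> cl_gamma = mat 1 \<and>
           (\<forall>v. dirac \<alpha> \<kappa> v = - (1/2) *\<^sub>R
              (casimir \<sigma>' v - op_tensor (casimir \<alpha>) id v - op_tensor id (casimir \<sigma>) v))) \<or>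
         (\<kappa> cl_gamma = - mat 1 \<and>
           (\<forall>v. dirac \<alpha> \<kappa> v = (1/2) *\<^sub>R
              (casimir \<sigma>' v - op_tensor (casimir \<alpha>) id v - op_tensor id (casimir \<sigma>) v)))"
proof -
  define M where "M v = (\<Sum>j\<in>UNIV. op_tensor (infinitesimal \<alpha> (su2E j)) ((*v) (\<kappa> (spin_gen j))) v)" for v
  have cas: "casimir \<sigma>' v - op_tensor (casimir \<alpha>) id v - op_tensor id (casimir \<sigma>) v = 2 *\<^sub>R M v" for v
    unfolding \<sigma>'_def \<sigma>_def \<alpha>_def M_def by (rule casimir_tensor_rep) fact+
  note gen = cliff_rep_gen_gamma[OF \<open>irreducible_cliff_star_rep \<kappa>\<close>]
  have neg: "(*v) (- A) = (\<lambda>x. - (A *v x))" for A :: "complex^2^2"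
    by (simp add: fun_eq_iff matrix_vector_mult_minus_left)
  have neg_mult: "(- mat 1) ** A = - A" for A :: "complex^2^2"
    by (simp add: vec_eq_iff matrix_matrix_mult_def mat_def sum_negf if_distrib if_distribR cong: if_cong)
  have dirac: "dirac \<alpha> \<kappa> v = (\<Sum>j\<in>UNIV. op_tensor (infinitesimal \<alpha> (su2E j)) ((*v) (\<kappa> (cl_gen j))) v)" for v
    by (simp add: dirac_def cl_vec_eps)
  from cliff_rep_gamma[OF \<open>irreducible_cliff_star_rep \<kappa>\<close>] show ?thesis
  proof
    assume g: "\<kappa> cl_gamma = mat 1"
    have "dirac \<alpha> \<kappa> v = - M v" for v
      by (simp add: dirac gen g neg op_tensor_minus_right sum_negf M_def)
    then show ?thesis by (simp add: cas g)
  next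
    assume g: "\<kappa> cl_gamma = - mat 1"
    have "dirac \<alpha> \<kappa> v = M v" for v
      by (simp add: dirac gen g neg_mult M_def)
    then show ?thesis by (simp add: cas g)
  qed
qed

end
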